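(* Let $D_1$ and $D_2$ be division rings, together with an anti-automorphism (i.e. a bijective, additive, multiplication-reversing map) $\varphi: D_1 \rightarrow D_2$. Let $n\ge1$, let $A_i = \mathrm{M}(n,D_i)$ for $i = 1,2$, and extend $\varphi$ to $\varphi: A_1 \rightarrow A_2$ componentwise (entry by entry). Consider the ring $A = A_1 \oplus A_2$ with the $\varphi$-flip transpose involution \[ (a_1,a_2)^* = (\varphi^{-1}(a_2)^t,\varphi(a_1)^t). \] Let $a, c \in A$ be such that \[ Aa + Ac = A, \qquad a^* c = c^* a. \] Then there exist \[ s \in A^{\mathrm{sym}} = \{ (x,\varphi(x)^t) \mid x \in A_1 \}, \qquad r \in A^\times, \] satisfying $a = s c + r$.
   Context: $A^{\mathrm{sym}}=\{x\in A: x^*=x\}$ is the set of symmetric elements, $A^\times$ is the group of units of $A$, and $t$ denotes matrix transpose. *)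

theory Defs
  imports "HOL-Analysis.Cartesian_Space" "HOL-Algebra.Chinese_Remainder"
begin

definition anti_automorphism :: "('d1::ring_1 \<Rightarrow> 'd2::ring_1) \<Rightarrow> bool" where
  "anti_automorphism \<phi> \<longleftrightarrow>
     bij \<phi> \<and> (\<forall>x y. \<phi> (x + y) = \<phi> x + \<phi> y) \<and> (\<forall>x y. \<phi> (x * y) = \<phi> y * \<phi> x)"

(* The multiplication must be the matrix product **, not the entrywise product "*" on vectors. *)
definition matrix_ring :: "('d::ring_1 ^ 'n ^ 'n) ring" where
  "matrix_ring = \<lparr>carrier = UNIV, mult = (**), one = mat 1, zero = 0, add = (+)\<rparr>"

lemma matrix_ring_is_ring: "ring (matrix_ring :: ('d::ring_1 ^ 'n ^ 'n) ring)"
proof (rule ringI)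
  show "abelian_group (matrix_ring :: ('d ^ 'n ^ 'n) ring)"
  proof (rule abelian_groupI)
    fix x :: "'d ^ 'n ^ 'n"
    show "\<exists>y \<in> carrier matrix_ring. y \<oplus>\<^bsub>matrix_ring\<^esub> x = \<zero>\<^bsub>matrix_ring\<^esub>"
      by (rule bexI[of _ "- x"]) (simp_all add: matrix_ring_def)
  qed (simp_all add: matrix_ring_def algebra_simps)
  show "Group.monoid (matrix_ring :: ('d ^ 'n ^ 'n) ring)"
    by (rule monoidI) (simp_all add: matrix_ring_def matrix_mul_assoc)
  show "(x \<oplus>\<^bsub>matrix_ring\<^esub> y) \<otimes>\<^bsub>matrix_ring\<^esub> z =
      x \<otimes>\<^bsub>matrix_ring\<^esub> z \<oplus>\<^bsub>matrix_ring\<^esub> y \<otimes>\<^bsub>matrix_ring\<^esub> z" for x y z :: "'d ^ 'n ^ 'n"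
    by (simp add: matrix_ring_def matrix_matrix_mult_def vec_eq_iff distrib_right sum.distrib)
  show "z \<otimes>\<^bsub>matrix_ring\<^esub> (x \<oplus>\<^bsub>matrix_ring\<^esub> y) =
      z \<otimes>\<^bsub>matrix_ring\<^esub> x \<oplus>\<^bsub>matrix_ring\<^esub> z \<otimes>\<^bsub>matrix_ring\<^esub> y" for x y z :: "'d ^ 'n ^ 'n"
    by (simp add: matrix_ring_def matrix_matrix_mult_def vec_eq_iff distrib_left sum.distrib)
qed

definition flip_ring :: "(('d1::ring_1 ^ 'n ^ 'n) \<times> ('d2::ring_1 ^ 'n ^ 'n)) ring" where
  "flip_ring = RDirProd matrix_ring matrix_ring"

lemma flip_ring_is_ring: "ring flip_ring"
  unfolding flip_ring_def by (intro RDirProd_ring matrix_ring_is_ring)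

lemma flip_ring_simps:
  "carrier flip_ring = UNIV"
  "x \<otimes>\<^bsub>flip_ring\<^esub> y = (fst x ** fst y, snd x ** snd y)"
  "x \<oplus>\<^bsub>flip_ring\<^esub> y = (fst x + fst y, snd x + snd y)"
  "\<one>\<^bsub>flip_ring\<^esub> = (mat 1, mat 1)"
  "\<zero>\<^bsub>flip_ring\<^esub> = (0, 0)"
  by (cases x; cases y; simp add: flip_ring_def RDirProd_def DirProd_def monoid.defs matrix_ring_def)+

definition flip_star ::
  "('d1 \<Rightarrow> 'd2) \<Rightarrow> ('d1::ring_1 ^ 'n ^ 'n) \<times> ('d2::ring_1 ^ 'n ^ 'n)
     \<Rightarrow> ('d1 ^ 'n ^ 'n) \<times> ('d2 ^ 'n ^ 'n)" where
  "flip_star \<phi> a =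
     (transpose (map_matrix (inv_into UNIV \<phi>) (snd a)), transpose (map_matrix \<phi> (fst a)))"

definition flip_sym ::
  "('d1 \<Rightarrow> 'd2) \<Rightarrow> (('d1::ring_1 ^ 'n ^ 'n) \<times> ('d2::ring_1 ^ 'n ^ 'n)) set" where
  "flip_sym \<phi> = {x \<in> carrier flip_ring. flip_star \<phi> x = x}"

lemma flip_star_involution:
  assumes "anti_automorphism \<phi>"
  shows "flip_star \<phi> (flip_star \<phi> x) = x"
    and "flip_star \<phi> (x \<oplus>\<^bsub>flip_ring\<^esub> y) = flip_star \<phi> x \<oplus>\<^bsub>flip_ring\<^esub> flip_star \<phi> y"
    and "flip_star \<phi> (x \<otimes>\<^bsub>flip_ring\<^esub> y) = flip_star \<phi> y \<otimes>\<^bsub>flip_ring\<^esub> flip_star \<phi> x"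
proof -
  let ?\<psi> = "inv_into UNIV \<phi>"
  have bij: "bij \<phi>" and add: "\<And>x y. \<phi> (x + y) = \<phi> x + \<phi> y"
    and mult: "\<And>x y. \<phi> (x * y) = \<phi> y * \<phi> x"
    using assms by (auto simp: anti_automorphism_def)
  have r: "\<phi> (?\<psi> y) = y" and l: "?\<psi> (\<phi> x) = x" for x y
    using bij by (simp_all add: bij_is_surj surj_f_inv_f bij_is_inj)
  have add': "?\<psi> (x + y) = ?\<psi> x + ?\<psi> y" for x y
    by (metis add l r)
  have mult': "?\<psi> (x * y) = ?\<psi> y * ?\<psi> x" for x y
    by (metis mult l r)
  have zero: "\<phi> 0 = 0" "?\<psi> 0 = 0"
    using add[of 0 0] add'[of 0 0] by simp_all
  have sum: "\<phi> (sum f A) = (\<Sum>i\<in>A. \<phi> (f i))" for f :: "'n \<Rightarrow> _" and A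
    by (induction A rule: infinite_finite_induct) (simp_all add: zero add)
  have sum': "?\<psi> (sum f A) = (\<Sum>i\<in>A. ?\<psi> (f i))" for f :: "'n \<Rightarrow> _" and A
    by (induction A rule: infinite_finite_induct) (simp_all add: zero add')
  show "flip_star \<phi> (flip_star \<phi> x) = x"
    by (simp add: flip_star_def map_matrix_def transpose_def r l prod_eq_iff vec_eq_iff)
  show "flip_star \<phi> (x \<oplus>\<^bsub>flip_ring\<^esub> y) = flip_star \<phi> x \<oplus>\<^bsub>flip_ring\<^esub> flip_star \<phi> y"
    by (simp add: flip_ring_simps flip_star_def map_matrix_def transpose_def add add' vec_eq_iff)
  show "flip_star \<phi> (x \<otimes>\<^bsub>flip_ring\<^esub> y) = flip_star \<phi> y \<otimes>\<^bsub>flip_ring\<^esub> flip_star \<phi> x"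
    by (simp add: flip_ring_simps flip_star_def map_matrix_def transpose_def
        matrix_matrix_mult_def sum sum' mult mult' vec_eq_iff)
qed

end

theory Submission
  imports Defs
begin

text \<open>
  The map \<open>x \<mapsto> \<phi>(x)\<^sup>t\<close> is an anti-isomorphism between the two matrix rings. Pulling the
  second components of \<open>a\<close> and \<open>c\<close> back along it gives matrices \<open>b\<close> and \<open>d\<close> over
  \<open>D\<^sub>1\<close>, that is, the first components of \<open>a\<^sup>*\<close> and \<open>c\<^sup>*\<close>. Writing \<open>a\<close> and \<open>c\<close> also
  for their own first components and \<open>M\<close> for \<open>M(n, D\<^sub>1)\<close>, the hypotheses become
  \<open>Ma + Mc = M\<close>, \<open>bM + dM = M\<close> and \<open>bc = da\<close>, and the goal becomes a single \<open>x\<close> for which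
  both \<open>a - xc\<close> and \<open>b - dx\<close> are units.

  The second condition on \<open>x\<close> follows from the first. If \<open>u = a - xc\<close> is a unit and
  \<open>v = b - dx\<close>, then \<open>bc = da\<close> gives \<open>vc = du\<close>; hence both \<open>d = v(cu\<^sup>-\<^sup>1)\<close> and
  \<open>b = v + dx\<close> lie in \<open>vM\<close>, so \<open>vM = M\<close>, and a right invertible element of \<open>M\<close> is a unit.

  What remains is that \<open>M\<close> has stable range one and that its right invertible elements are units.
  Both hold in every unit-regular ring, where each \<open>c\<close> satisfies \<open>cgc = c\<close> for some unit \<open>g\<close>
  (\<open>unit_regular_stable_range\<close>, \<open>unit_regular_right_invertible_imp_Units\<close>).
  A matrix ring over a division ring is unit-regular because Gaussian elimination makes every matrix
  diagonal, and a diagonal matrix is handled entry by entry (\<open>unit_regular_matrix_ring\<close>).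
\<close>

section \<open>Unit-regular rings\<close>

definition unit_regular :: "('a, 'b) ring_scheme \<Rightarrow> bool" where
  "unit_regular R \<longleftrightarrow>
     (\<forall>c \<in> carrier R. \<exists>g \<in> Units R. c \<otimes>\<^bsub>R\<^esub> g \<otimes>\<^bsub>R\<^esub> c = c)"

text \<open>
  A right inverse \<open>y\<close> of \<open>x\<close> can be cancelled from \<open>xgx = x\<close>, which leaves \<open>xg = 1\<close>: \<open>x\<close> is the
  inverse of the unit \<open>g\<close>.
\<close>

lemma (in ring) unit_regular_right_invertible_imp_Units:
  assumes "unit_regular R" and x: "x \<in> carrier R" and y: "y \<in> carrier R" and xy: "x \<otimes> y = \<one>"
  shows "x \<in> Units R"
proof -
  obtain g where g: "g \<in> Units R" and xgx: "x \<otimes> g \<otimes> x = x"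
    using assms(1) x by (auto simp: unit_regular_def)
  have "x \<otimes> g = x \<otimes> g \<otimes> (x \<otimes> y)"
    using x Units_closed[OF g] by (simp add: xy)
  also have "\<dots> = \<one>"
    using x y g by (metis xgx xy m_assoc m_closed Units_closed)
  finally have "x = inv g"
    using x g by (metis m_assoc Units_closed Units_inv_closed Units_r_inv l_one r_one)
  then show ?thesis
    using g by simp
qed

text \<open>
  Unit-regular rings have stable range one. With \<open>cgc = c\<close>, the idempotent \<open>e = gc\<close> generates the
  left ideal \<open>Rc\<close>, so the part \<open>ae\<close> of \<open>a\<close> can be replaced by any element of \<open>Re\<close>, and it is enough
  to complete \<open>w = a(1 - e)\<close> to a unit. Unimodularity makes \<open>w\<close> generate the same left ideal as
  \<open>f = 1 - e\<close>. Unit-regularity, applied to \<open>w\<close>, writes \<open>w\<close> as a unit \<open>k\<^sup>-\<^sup>1\<close> times an idempotent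
  \<open>h\<close> generating this ideal as well. Two idempotents generating the same left ideal differ
  by an element of square zero, so \<open>h + e = 1 + (h - f)\<close> is a unit, and
  \<open>k\<^sup>-\<^sup>1(h + e) = w + k\<^sup>-\<^sup>1e\<close> is the required completion.
\<close>

lemma (in ring) unit_regular_stable_range:
  assumes "unit_regular R"
    and a: "a \<in> carrier R" and c: "c \<in> carrier R" and y: "y \<in> carrier R" and z: "z \<in> carrier R"
    and unimodular: "y \<otimes> a \<oplus> z \<otimes> c = \<one>"
  shows "\<exists>x \<in> carrier R. a \<ominus> x \<otimes> c \<in> Units R"
proof -
  obtain g where g: "g \<in> Units R" and cgc: "c \<otimes> g \<otimes> c = c"
    using assms(1) c by (auto simp: unit_regular_def)
  define e where "e = g \<otimes> c"
  define f where "f = \<one> \<ominus> e"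
  define w where "w = a \<otimes> f"
  note gc = Units_closed[OF g]
  have ec: "e \<in> carrier R" and fc: "f \<in> carrier R" and wc: "w \<in> carrier R"
    using a c gc by (simp_all add: e_def f_def w_def)
  have ce: "c \<otimes> e = c"
    using c gc cgc by (simp add: e_def m_assoc)
  have ee: "e \<otimes> e = e"
    using c gc ce ec by (metis e_def m_assoc)
  have cf: "c \<otimes> f = \<zero>"
    using c ec by (simp add: f_def minus_eq r_distr r_minus ce r_neg)
  have ff: "f \<otimes> f = f"
    using ec ee by (simp add: f_def minus_eq r_distr l_distr r_minus l_minus minus_add r_neg l_neg)
  have yw: "y \<otimes> w = f"
  proof -
    have "f = (y \<otimes> a \<oplus> z \<otimes> c) \<otimes> f"
      using fc by (simp add: unimodular)
    also have "\<dots> = y \<otimes> w"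
      using a c y z fc by (simp add: l_distr m_assoc cf w_def)
    finally show ?thesis by simp
  qed
  have wf: "w \<otimes> f = w"
    using a fc by (simp add: w_def m_assoc ff)
  obtain k where k: "k \<in> Units R" and wkw: "w \<otimes> k \<otimes> w = w"
    using assms(1) wc by (auto simp: unit_regular_def)
  note kc = Units_closed[OF k]
  define h where "h = k \<otimes> w"
  have hc: "h \<in> carrier R"
    using kc wc by (simp add: h_def)
  have hh: "h \<otimes> h = h"
    using kc wc wkw by (simp add: h_def m_assoc)
  have hf: "h \<otimes> f = h"
    using kc wc fc by (simp add: h_def m_assoc wf)
  have fh: "f \<otimes> h = f"
  proof -
    have "f \<otimes> h = y \<otimes> (w \<otimes> k \<otimes> w)"
      using kc wc y by (simp add: yw[symmetric] h_def m_assoc)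
    then show ?thesis by (simp add: wkw yw)
  qed
  define d where "d = h \<ominus> f"
  have dc: "d \<in> carrier R"
    using hc fc by (simp add: d_def)
  have dd: "d \<otimes> d = \<zero>"
  proof -
    have "d \<otimes> d = (h \<ominus> h) \<oplus> (f \<ominus> f)"
      using hc fc
      by (simp add: d_def minus_eq r_distr l_distr r_minus l_minus hh hf fh ff minus_add a_ac)
    then show ?thesis
      using hc fc by (simp add: minus_eq r_neg)
  qed
  have t: "\<one> \<oplus> d \<in> Units R"
  proof -
    have "(\<one> \<oplus> d) \<otimes> (\<one> \<ominus> d) = \<one>" "(\<one> \<ominus> d) \<otimes> (\<one> \<oplus> d) = \<one>"
      using dc by (simp_all add: minus_eq r_distr l_distr r_minus l_minus dd a_assoc l_neg r_neg)
    then show ?thesis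
      using dc by (auto simp: Units_def)
  qed
  have kk: "inv k \<otimes> h = w"
    using k kc wc by (simp add: h_def m_assoc[symmetric])
  \<comment> \<open>Chosen so that subtracting \<open>xc = (a - k\<^sup>-\<^sup>1)e\<close> replaces \<open>ae\<close> by \<open>k\<^sup>-\<^sup>1e\<close>.\<close>
  define x where "x = (a \<ominus> inv k) \<otimes> g"
  have ik: "inv k \<in> carrier R" using k by simp
  have "a \<ominus> x \<otimes> c = a \<ominus> (a \<ominus> inv k) \<otimes> e"
    using a c gc ik by (simp add: x_def e_def m_assoc)
  also have "\<dots> = w \<oplus> inv k \<otimes> e"
    using a ec ik by (simp add: w_def f_def minus_eq r_distr l_distr r_minus l_minus minus_add a_assoc)
  also have "\<dots> = inv k \<otimes> (h \<oplus> e)"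
    using hc ec ik by (simp add: r_distr kk)
  also have "h \<oplus> e = \<one> \<oplus> d"
    using hc ec by (simp add: d_def f_def minus_eq minus_add a_ac r_neg r_neg1 r_neg2)
  finally have "a \<ominus> x \<otimes> c \<in> Units R"
    using k t by simp
  moreover have "x \<in> carrier R"
    using a gc ik by (simp add: x_def)
  ultimately show ?thesis by blast
qed

text \<open>
  Stable range one yields \<open>x\<close> with \<open>u = a - xc\<close> a unit. The relation \<open>bc = da\<close> then puts
  both \<open>b\<close> and \<open>d\<close> in the right ideal of \<open>v = b - dx\<close>, so the right unimodularity of \<open>(b, d)\<close> passes
  to \<open>v\<close>.
\<close>

lemma (in ring) unit_regular_simultaneous_units:
  assumes ur: "unit_regular R"
    and carr: "a \<in> carrier R" "c \<in> carrier R" "b \<in> carrier R" "d \<in> carrier R"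
      "y \<in> carrier R" "z \<in> carrier R" "y' \<in> carrier R" "z' \<in> carrier R"
    and left: "y \<otimes> a \<oplus> z \<otimes> c = \<one>"
    and right: "b \<otimes> y' \<oplus> d \<otimes> z' = \<one>"
    and bc: "b \<otimes> c = d \<otimes> a"
  shows "\<exists>x \<in> carrier R. a \<ominus> x \<otimes> c \<in> Units R \<and> b \<ominus> d \<otimes> x \<in> Units R"
proof -
  obtain x where x: "x \<in> carrier R" and u: "a \<ominus> x \<otimes> c \<in> Units R"
    using unit_regular_stable_range[OF ur carr(1,2,5,6) left] by blast
  define u where "u = a \<ominus> x \<otimes> c"
  define v where "v = b \<ominus> d \<otimes> x"
  define p where "p = c \<otimes> inv u"
  have uU: "u \<in> Units R" and uc: "u \<in> carrier R" and vc: "v \<in> carrier R" and pc: "p \<in> carrier R"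
    using x u carr by (auto simp: u_def v_def p_def)
  have "v \<otimes> c = d \<otimes> u"
    using x carr by (simp add: u_def v_def minus_eq r_distr l_distr r_minus l_minus m_assoc bc)
  then have d: "v \<otimes> p = d"
    using carr uU uc vc by (simp add: p_def m_assoc[symmetric]) (simp add: m_assoc)
  define q where "q = \<one> \<oplus> p \<otimes> x"
  have qc: "q \<in> carrier R"
    using pc x by (simp add: q_def)
  have b: "v \<otimes> q = b"
  proof -
    have "v \<otimes> q = v \<oplus> d \<otimes> x"
      using vc pc x by (simp add: q_def r_distr m_assoc[symmetric] d)
    also have "\<dots> = b"
      using x carr by (simp add: v_def minus_eq a_assoc l_neg)
    finally show ?thesis by simp
  qed
  have "v \<otimes> (q \<otimes> y' \<oplus> p \<otimes> z') = v \<otimes> q \<otimes> y' \<oplus> v \<otimes> p \<otimes> z'"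
    using vc pc qc carr by (simp add: r_distr m_assoc)
  then have "v \<otimes> (q \<otimes> y' \<oplus> p \<otimes> z') = \<one>"
    by (simp add: b d right)
  then have "v \<in> Units R"
    using vc pc qc carr by (intro unit_regular_right_invertible_imp_Units[OF ur]) auto
  with x u show ?thesis
    by (auto simp: v_def)
qed

section \<open>Gaussian elimination over a division ring\<close>

text \<open>
  Elementary matrices that differ from the identity in a single row or column. The diagonal
  entry is \<open>1\<close> whatever \<open>v k\<close> and \<open>w k\<close> are, so both matrices are invertible. Right
  multiplication by the first adds right multiples of column \<open>k\<close> to the other columns at once;
  left multiplication by the second adds left multiples of row \<open>k\<close> to the other rows.
\<close>

definition row_transvection :: "'n \<Rightarrow> ('n \<Rightarrow> 'd) \<Rightarrow> 'd::ring_1 ^ 'n ^ 'n" where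
  "row_transvection k v = (\<chi> r s. if r = s then 1 else if r = k then v s else 0)"

definition column_transvection :: "'n \<Rightarrow> ('n \<Rightarrow> 'd) \<Rightarrow> 'd::ring_1 ^ 'n ^ 'n" where
  "column_transvection k w = (\<chi> r s. if r = s then 1 else if s = k then w r else 0)"

lemma mult_row_transvection:
  "(c ** row_transvection k v) $ r $ s = (if s = k then c $ r $ k else c $ r $ s + c $ r $ k * v s)"
proof -
  have "(c ** row_transvection k v) $ r $ s =
      (\<Sum>t\<in>UNIV. (if t = s then c $ r $ t else 0) + (if t = k then (if s = k then 0 else c $ r $ t * v s) else 0))"
    unfolding matrix_matrix_mult_def row_transvection_def vec_lambda_beta
    by (intro sum.cong) auto
  then show ?thesis
    by (simp add: sum.distrib)
qed

lemma column_transvection_mult: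
  "(column_transvection k w ** c) $ r $ s = (if r = k then c $ k $ s else c $ r $ s + w r * c $ k $ s)"
proof -
  have "(column_transvection k w ** c) $ r $ s =
      (\<Sum>t\<in>UNIV. (if t = r then c $ t $ s else 0) + (if t = k then (if r = k then 0 else w r * c $ t $ s) else 0))"
    unfolding matrix_matrix_mult_def column_transvection_def vec_lambda_beta
    by (intro sum.cong) auto
  then show ?thesis
    by (simp add: sum.distrib)
qed

lemma invertible_row_transvection: "invertible (row_transvection k v)"
proof -
  have "row_transvection k u ** row_transvection k (\<lambda>s. - u s) = mat 1" for u :: "'b \<Rightarrow> 'a"
    by (simp add: vec_eq_iff mult_row_transvection) (simp add: row_transvection_def mat_def)
  from this[of v] this[of "\<lambda>s. - v s"] show ?thesis
    by (auto simp: invertible_def)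
qed

lemma invertible_column_transvection: "invertible (column_transvection k w)"
proof -
  have "column_transvection k u ** column_transvection k (\<lambda>r. - u r) = mat 1" for u :: "'b \<Rightarrow> 'a"
    by (simp add: vec_eq_iff column_transvection_mult) (simp add: column_transvection_def mat_def)
  from this[of w] this[of "\<lambda>r. - w r"] show ?thesis
    by (auto simp: invertible_def)
qed

text \<open>
  The generalised inverse inverts the nonzero diagonal entries; it has to be invertible itself, so
  the zero entries are replaced by \<open>1\<close>.
\<close>

lemma diagonal_matrix_unit_regular:
  fixes c :: "'d::division_ring ^ 'n ^ 'n"
  assumes diag: "\<And>r s. r \<noteq> s \<Longrightarrow> c $ r $ s = 0"
  shows "\<exists>g. invertible g \<and> c ** g ** c = c"
proof -
  define D :: "('n \<Rightarrow> 'd) \<Rightarrow> 'd ^ 'n ^ 'n" where "D u = (\<chi> r s. if r = s then u r else 0)" for u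
  have D_mult: "D u ** D v = D (\<lambda>r. u r * v r)" for u v
    by (simp add: D_def matrix_matrix_mult_def vec_eq_iff if_distrib [of "\<lambda>x. x * _"] cong: if_cong)
  define i where "i r = (if c $ r $ r = 0 then 1 else inverse (c $ r $ r))" for r
  have "c = D (\<lambda>r. c $ r $ r)"
    using diag by (auto simp: D_def vec_eq_iff)
  moreover have "D (\<lambda>r. c $ r $ r) ** D i ** D (\<lambda>r. c $ r $ r) = D (\<lambda>r. c $ r $ r)"
    by (auto simp: D_mult i_def intro!: arg_cong[of _ _ D])
  moreover have "D i ** D (\<lambda>r. inverse (i r)) = mat 1" "D (\<lambda>r. inverse (i r)) ** D i = mat 1"
    unfolding D_mult by (simp_all add: D_def i_def mat_def vec_eq_iff)
  ultimately show ?thesis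
    unfolding invertible_def by metis
qed

text \<open>
  If \<open>g\<close> serves \<open>pcq\<close>, then \<open>qgp\<close> serves \<open>c\<close>; so elementary row and column operations may be applied
  freely in the search for \<open>g\<close>.
\<close>

lemma unit_regular_equivalent_matrix:
  fixes c :: "'d::ring_1 ^ 'n ^ 'n"
  assumes p: "invertible p" and q: "invertible q"
    and "\<exists>g. invertible g \<and> (p ** c ** q) ** g ** (p ** c ** q) = p ** c ** q"
  shows "\<exists>g. invertible g \<and> c ** g ** c = c"
proof -
  obtain p' q' where p': "p' ** p = mat 1" and q': "q ** q' = mat 1"
    using p q by (auto simp: invertible_def)
  obtain g where g: "invertible g" and eq: "(p ** c ** q) ** g ** (p ** c ** q) = p ** c ** q"
    using assms(3) by blast
  have "p' ** ((p ** c ** q) ** g ** (p ** c ** q)) ** q' = (p' ** p) ** (c ** (q ** g ** p) ** c) ** (q ** q')"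
    by (simp add: matrix_mul_assoc)
  moreover have "p' ** (p ** c ** q) ** q' = (p' ** p) ** c ** (q ** q')"
    by (simp add: matrix_mul_assoc)
  ultimately have "c ** (q ** g ** p) ** c = c"
    by (simp add: eq p' q')
  moreover have "invertible (q ** g ** p)"
    using p q g by (intro invertible_mult)
  ultimately show ?thesis by blast
qed

text \<open>
  Gaussian elimination, as an induction on the block \<open>S \<times> S\<close> outside which the matrix is already
  diagonal. A nonzero off-diagonal entry lies in the block, and one pivot operation clears a row and
  a column of it, which removes their common index from \<open>S\<close>. Every matrix satisfies the assumption when
  \<open>S\<close> is the set of all indices.
\<close>

lemma matrix_unit_regular_if_diagonal_off_block:
  fixes c :: "'d::division_ring ^ 'n ^ 'n"
  assumes "finite S" and "\<And>r s. r \<noteq> s \<Longrightarrow> r \<notin> S \<or> s \<notin> S \<Longrightarrow> c $ r $ s = 0"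
  shows "\<exists>g. invertible g \<and> c ** g ** c = c"
  using assms
proof (induction S arbitrary: c rule: finite_psubset_induct)
  case (psubset S)
  show ?case
  proof (cases "\<forall>r s. r \<noteq> s \<longrightarrow> c $ r $ s = 0")
    case True
    then show ?thesis by (simp add: diagonal_matrix_unit_regular)
  next
    case False
    then obtain i j where ij: "i \<noteq> j" "c $ i $ j \<noteq> 0" by blast
    with psubset.prems have S: "i \<in> S" "j \<in> S" by blast+
    \<comment> \<open>The pivot is needed at the diagonal position \<open>(i, i)\<close>. If that entry vanishes, adding column \<open>j\<close>
      to column \<open>i\<close> makes it \<open>c $ i $ j\<close>, and keeps the block shape because \<open>j \<in> S\<close>.\<close>
    obtain q where q: "invertible q" and pivot: "(c ** q) $ i $ i \<noteq> 0"
      and shape: "\<And>r s. r \<noteq> s \<Longrightarrow> r \<notin> S \<or> s \<notin> S \<Longrightarrow> (c ** q) $ r $ s = 0"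
    proof (cases "c $ i $ i = 0")
      case True
      define T where "T = row_transvection j (\<lambda>s. if s = i then 1 else 0 :: 'd)"
      have entry: "(c ** T) $ r $ s = c $ r $ s + (if s = i then c $ r $ j else 0)" for r s
        using ij by (simp add: T_def mult_row_transvection)
      show thesis
      proof (rule that[of T])
        show "invertible T"
          by (simp add: T_def invertible_row_transvection)
        show "(c ** T) $ i $ i \<noteq> 0"
          using ij True by (simp add: entry)
        show "(c ** T) $ r $ s = 0" if "r \<noteq> s" "r \<notin> S \<or> s \<notin> S" for r s
          using that S psubset.prems[of r s] psubset.prems[of r j] by (auto simp: entry)
      qed
    next
      case False
      then show thesis
        using psubset.prems by (intro that[of "mat 1"]) (auto simp: invertible_def intro: exI[of _ "mat 1"])
    qed
    define b where "b = c ** q"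
    \<comment> \<open>Clear column \<open>i\<close> from the left and row \<open>i\<close> from the right. As multiplication does not commute,
      the inverse of the pivot stands to the right of the column entries and to the left of the row
      entries.\<close>
    define p where "p = column_transvection i (\<lambda>r. - (b $ r $ i * inverse (b $ i $ i)))"
    define t where "t = row_transvection i (\<lambda>s. - (inverse (b $ i $ i) * b $ i $ s))"
    have b: "b $ i $ i \<noteq> 0" "\<And>r s. r \<noteq> s \<Longrightarrow> r \<notin> S \<or> s \<notin> S \<Longrightarrow> b $ r $ s = 0"
      using pivot shape by (simp_all add: b_def)
    have entry: "(p ** b ** t) $ r $ s =
        (if r = i \<and> s = i then b $ i $ i else if r = i \<or> s = i then 0
         else b $ r $ s - b $ r $ i * inverse (b $ i $ i) * b $ i $ s)" for r s
      using b(1) by (simp add: p_def t_def mult_row_transvection column_transvection_mult mult.assoc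
         mult.assoc[symmetric, of "b $ i $ i" "inverse _"])
    have "\<exists>g. invertible g \<and> (p ** b ** t) ** g ** (p ** b ** t) = p ** b ** t"
    proof (rule psubset.IH[of "S - {i}"])
      show "S - {i} \<subset> S"
        using S by blast
      show "(p ** b ** t) $ r $ s = 0" if "r \<noteq> s" "r \<notin> S - {i} \<or> s \<notin> S - {i}" for r s
        using that b(2)[of r s] b(2)[of r i] b(2)[of i s] by (auto simp: entry)
    qed
    then have "\<exists>g. invertible g \<and> p ** c ** (q ** t) ** g ** (p ** c ** (q ** t)) = p ** c ** (q ** t)"
      by (simp add: b_def matrix_mul_assoc)
    moreover have "invertible p" "invertible (q ** t)"
      by (simp_all add: p_def t_def q invertible_mult invertible_row_transvection
          invertible_column_transvection)
    ultimately show ?thesis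
      by (blast intro: unit_regular_equivalent_matrix)
  qed
qed

lemma matrix_ring_simps:
  "carrier matrix_ring = UNIV"
  "x \<otimes>\<^bsub>matrix_ring\<^esub> y = x ** y"
  "x \<oplus>\<^bsub>matrix_ring\<^esub> y = x + y"
  "\<one>\<^bsub>matrix_ring\<^esub> = mat 1"
  by (simp_all add: matrix_ring_def)

lemma Units_matrix_ring: "Units matrix_ring = {x. invertible x}"
  by (auto simp: Units_def matrix_ring_simps invertible_def)

lemma a_minus_matrix_ring: "x \<ominus>\<^bsub>matrix_ring\<^esub> y = x - y"
proof -
  interpret ring "matrix_ring :: ('a ^ 'b ^ 'b) ring" by (rule matrix_ring_is_ring)
  have "\<ominus>\<^bsub>matrix_ring\<^esub> y = - y"
    by (rule minus_equality) (simp_all add: matrix_ring_def)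
  then show ?thesis
    by (simp add: minus_eq matrix_ring_simps)
qed

lemma unit_regular_matrix_ring:
  "unit_regular (matrix_ring :: ('d::division_ring ^ 'n ^ 'n) ring)"
  using matrix_unit_regular_if_diagonal_off_block[of UNIV]
  by (auto simp: unit_regular_def matrix_ring_simps Units_matrix_ring)

section \<open>The flip transpose involution\<close>

theorem lemma3p1p3:
  fixes \<phi> :: "'d1::division_ring \<Rightarrow> 'd2::division_ring"
    and A :: "(('d1 ^ 'n ^ 'n) \<times> ('d2 ^ 'n ^ 'n)) ring" (structure)
    and a c :: "('d1 ^ 'n ^ 'n) \<times> ('d2 ^ 'n ^ 'n)"
  defines "A \<equiv> flip_ring"
  assumes "anti_automorphism \<phi>"
    and "a \<in> carrier A" and "c \<in> carrier A"
    and "(carrier A #> a) <+> (carrier A #> c) = carrier A"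
    and "flip_star \<phi> a \<otimes> c = flip_star \<phi> c \<otimes> a"
  shows "flip_sym \<phi> = {(x, transpose (map_matrix \<phi> x)) | x :: 'd1 ^ 'n ^ 'n. True}
    \<and> (\<exists>s \<in> flip_sym \<phi>. \<exists>r \<in> Units A. a = s \<otimes> c \<oplus> r)"
proof -
  define \<psi> :: "'d1 ^ 'n ^ 'n \<Rightarrow> 'd2 ^ 'n ^ 'n" where "\<psi> x = transpose (map_matrix \<phi> x)" for x
  define \<theta> :: "'d2 ^ 'n ^ 'n \<Rightarrow> 'd1 ^ 'n ^ 'n"
    where "\<theta> y = transpose (map_matrix (inv_into UNIV \<phi>) y)" for y
  have star: "flip_star \<phi> z = (\<theta> (snd z), \<psi> (fst z))" for z :: "('d1 ^ 'n ^ 'n) \<times> ('d2 ^ 'n ^ 'n)"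
    by (simp add: flip_star_def \<psi>_def \<theta>_def)
  note involution = flip_star_involution[OF assms(2), unfolded flip_ring_simps]
  have \<theta>\<psi>: "\<theta> (\<psi> x) = x" and \<psi>\<theta>: "\<psi> (\<theta> y) = y" for x y
    using involution(1)[of "(x, y)"] by (simp_all add: star)
  have \<psi>_add: "\<psi> (x + x') = \<psi> x + \<psi> x'" and \<theta>_add: "\<theta> (y + y') = \<theta> y + \<theta> y'" for x x' y y'
    using involution(2)[of "(x, y)" "(x', y')"] by (simp_all add: star)
  have \<psi>_mult: "\<psi> (x ** x') = \<psi> x' ** \<psi> x" and \<theta>_mult: "\<theta> (y ** y') = \<theta> y' ** \<theta> y" for x x' y y'
    using involution(3)[of "(x, y)" "(x', y')"] by (simp_all add: star)
  have \<psi>_one: "\<psi> (mat 1) = mat 1"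
    by (metis \<psi>\<theta> \<psi>_mult matrix_mul_lid matrix_mul_rid)
  have \<psi>_invertible: "invertible (\<psi> x)" if "invertible x" for x
    using that unfolding invertible_def by (metis \<psi>_mult \<psi>_one)
  have sym: "flip_sym \<phi> = {(x, \<psi> x) | x. True}"
    by (auto simp: flip_sym_def flip_ring_simps star \<theta>\<psi>)

  obtain a1 a2 c1 c2 where ac: "a = (a1, a2)" "c = (c1, c2)"
    by fastforce
  have "\<one>\<^bsub>A\<^esub> \<in> (carrier A #> a) <+> (carrier A #> c)"
    unfolding assms(5) by (simp add: A_def flip_ring_simps)
  then obtain h k where "h \<otimes> a \<oplus> k \<otimes> c = \<one>"
    unfolding set_add_def' r_coset_def by auto
  then have left: "fst h ** a1 + fst k ** c1 = mat 1" and right: "snd h ** a2 + snd k ** c2 = mat 1"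
    by (simp_all add: A_def flip_ring_simps ac)
  \<comment> \<open>Pull the second components back to the first matrix ring; this reverses products, so left
    unimodularity there becomes right unimodularity here.\<close>
  define b d where "b = \<theta> a2" and "d = \<theta> c2"
  have right': "b ** \<theta> (snd h) + d ** \<theta> (snd k) = mat 1"
    using arg_cong[OF right, of \<theta>] \<theta>\<psi>[of "mat 1"] by (simp add: b_def d_def \<theta>_add \<theta>_mult \<psi>_one)
  have bc: "b ** c1 = d ** a1"
    using assms(6) by (simp add: A_def flip_ring_simps star ac b_def d_def)

  interpret M: ring "matrix_ring :: ('d1 ^ 'n ^ 'n) ring" by (rule matrix_ring_is_ring)
  obtain x where u: "invertible (a1 - x ** c1)" and v: "invertible (b - d ** x)"
    using M.unit_regular_simultaneous_units[OF unit_regular_matrix_ring,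
        unfolded matrix_ring_simps a_minus_matrix_ring Units_matrix_ring,
        OF UNIV_I UNIV_I UNIV_I UNIV_I UNIV_I UNIV_I UNIV_I UNIV_I left right' bc]
    by auto
  define r where "r = (a1 - x ** c1, \<psi> (b - d ** x))"
  have "r \<in> Units A"
    using u \<psi>_invertible[OF v]
    by (auto simp: r_def A_def Units_def flip_ring_simps invertible_def)
  moreover have "a = (x, \<psi> x) \<otimes> c \<oplus> r"
  proof -
    have "a2 = \<psi> (d ** x + (b - d ** x))"
      by (simp add: b_def \<psi>\<theta>)
    also have "\<dots> = \<psi> x ** c2 + \<psi> (b - d ** x)"
      by (simp only: \<psi>_add \<psi>_mult d_def \<psi>\<theta>)
    finally show ?thesis
      by (simp add: A_def flip_ring_simps ac r_def)
  qed
  ultimately show ?thesis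
    unfolding sym \<psi>_def[symmetric] by blast
qed

end
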